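(* Let $X$ be the maximal random complex over $N$ vertices. For every $n\ge 0$ the expected $n$-th Betti number of $X$, as a reduced polynomial in the cell probabilities, has the structure $$b_n^E=p_n^E+(-1)^{n+1}d_{n+1}+p_{n+1}^E .$$
   Context: Maximal random complex over $N$ vertices: the random subcomplex of the full simplex on $\{1,\dots,N\}$ in which each vertex $i$ is present independently with probability $p_i$, and each cell $\sigma$ of positive dimension, given that all its proper faces are present, is present with probability $p_\sigma$, independently of everything else (if some face is missing, $\sigma$ is absent). Expected Betti number: $b_n^E=\sum_\Delta b_n(\Delta)p(\Delta)$, where $\Delta$ runs over all possible realizations, $p(\Delta)$ is the probability of $\Delta$, and $b_n$ is the (unreduced) $n$-th Betti number over a fixed field. The reduced polynomial is obtained by fully expanding and collecting terms. For a subcomplex $\Gamma$ of the full simplex, $\mathrm{mon}(\Gamma)=\prod_{\sigma\in\Gamma}p_\sigma$, the product over all nonempty cells of $\Gamma$ (each cell once; for a vertex $i$ the factor is $p_i$). For a set of $k$-cells, the complex it generates consists of these cells and all their faces. For $k\ge1$ and a complex $\Gamma$ generated by a finite set $F$ of $k$-cells, $c_k(\Gamma)=\sum_{S\subseteq F}(-1)^{|S|}b_k(\Gamma\setminus S)$ if $b_k(\Gamma)\ne0$, and $c_k(\Gamma)=0$ if $b_k(\Gamma)=0$; here $\Gamma\setminus S$ is $\Gamma$ with the $k$-cells in $S$ removed. $p_k^E$ (for $k\ge 1$) is the polynomial corresponding to the higher order terms of $k$-cells, $p_k^E=\sum_\Gamma c_k(\Gamma)\,\mathrm{mon}(\Gamma)$,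 where $\Gamma$ runs over all complexes generated by nonempty sets of $k$-cells of the full simplex; $p_0^E=p_1+\dots+p_N$ is the sum of the vertex probabilities. $d_{k}$ is the polynomial corresponding to the $k$-cells, $d_k=\sum_\sigma \mathrm{mon}(\bar\sigma)$, where $\sigma$ runs over all $k$-cells of the full simplex and $\bar\sigma$ is the complex generated by $\sigma$. If there are no $k$-cells, $d_k=p_k^E=0$.
   Formalization: The sign of d_{n+1} is corrected from (-1)^{n+1} to -1 for every n: as printed the formula fails for odd n with N ≥ n+2, e.g. N=3, n=1, where b_1^E = M - M p_{123} (M the product of all vertex and edge probabilities) but the printed formula gives M + M p_{123}. *)

theory Defs
  imports "HOL-Library.Poly_Mapping" "HOL-Probability.Probability"
begin

section \<open>Simplicial complexes\<close>

text \<open>Cells are nonempty finite sets of vertices; the empty set is never a cell.\<close>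

definition full_simplex :: "nat \<Rightarrow> nat set set" where
  "full_simplex N = Pow {1..N} - {{}}"

definition subcomplexes :: "nat \<Rightarrow> nat set set set" where
  "subcomplexes N =
     {\<Delta>. \<Delta> \<subseteq> full_simplex N \<and> (\<forall>\<sigma>\<in>\<Delta>. \<forall>\<tau>. \<tau> \<subseteq> \<sigma> \<and> \<tau> \<noteq> {} \<longrightarrow> \<tau> \<in> \<Delta>)}"

definition kcells :: "nat \<Rightarrow> nat set set \<Rightarrow> nat set set" where
  "kcells k \<Delta> = {\<sigma>\<in>\<Delta>. card \<sigma> = k + 1}"

definition generated_complex :: "nat set set \<Rightarrow> nat set set" where
  "generated_complex F = {\<tau>. \<tau> \<noteq> {} \<and> (\<exists>\<sigma>\<in>F. \<tau> \<subseteq> \<sigma>)}"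


section \<open>Betti numbers over a field\<close>

text \<open>Chains with coefficients in a field are finitely supported functions on cells.\<close>

definition chain_scale :: "'k::field \<Rightarrow> (nat set \<Rightarrow>\<^sub>0 'k) \<Rightarrow> (nat set \<Rightarrow>\<^sub>0 'k)" where
  "chain_scale a c = Poly_Mapping.map (\<lambda>x. a * x) c"

lemma lookup_chain_scale:
  "Poly_Mapping.lookup (chain_scale a c) \<sigma> = a * Poly_Mapping.lookup c \<sigma>"
  by (simp add: chain_scale_def Poly_Mapping.map.rep_eq when_def)

interpretation chain: vector_space "chain_scale :: 'k::field \<Rightarrow> _"
  by unfold_locales
    (auto intro!: poly_mapping_eqI simp: lookup_chain_scale lookup_add algebra_simps)

definition chains :: "nat \<Rightarrow> nat set set \<Rightarrow> (nat set \<Rightarrow>\<^sub>0 'k::field) set" where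
  "chains n \<Delta> = {c. Poly_Mapping.keys c \<subseteq> kcells n \<Delta>}"

text \<open>
  Every cell is oriented by the order of its vertices, so deleting the vertex at position \<open>j\<close>
  (counted from \<open>0\<close>) contributes with sign \<open>(-1)^j\<close>.  The boundary of a \<open>0\<close>-chain is zero,
  hence the homology is unreduced.
\<close>

definition cell_boundary :: "nat set \<Rightarrow> (nat set \<Rightarrow>\<^sub>0 'k::field)" where
  "cell_boundary \<sigma> =
     (\<Sum>v\<in>\<sigma>. Poly_Mapping.single (\<sigma> - {v}) ((-1) ^ card {w\<in>\<sigma>. w < v}))"

definition boundary :: "nat \<Rightarrow> (nat set \<Rightarrow>\<^sub>0 'k::field) \<Rightarrow> (nat set \<Rightarrow>\<^sub>0 'k)" where
  "boundary n c =
     (if n = 0 then 0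
      else \<Sum>\<sigma>\<in>Poly_Mapping.keys c. chain_scale (Poly_Mapping.lookup c \<sigma>) (cell_boundary \<sigma>))"

definition cycles :: "nat \<Rightarrow> nat set set \<Rightarrow> (nat set \<Rightarrow>\<^sub>0 'k::field) set" where
  "cycles n \<Delta> = {c \<in> chains n \<Delta>. boundary n c = 0}"

definition boundaries :: "nat \<Rightarrow> nat set set \<Rightarrow> (nat set \<Rightarrow>\<^sub>0 'k::field) set" where
  "boundaries n \<Delta> = boundary (n + 1) ` chains (n + 1) \<Delta>"

text \<open>
  The dimension of the quotient of cycles by boundaries.  On a finite complex the boundaries
  form a subspace of the finite-dimensional space of cycles, so the subtraction does not
  truncate.
\<close>

definition betti :: "'k::field itself \<Rightarrow> nat \<Rightarrow> nat set set \<Rightarrow> nat" where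
  "betti K n \<Delta> =
     chain.dim (cycles n \<Delta> :: (nat set \<Rightarrow>\<^sub>0 'k) set)
     - chain.dim (boundaries n \<Delta> :: (nat set \<Rightarrow>\<^sub>0 'k) set)"


section \<open>The maximal random complex\<close>

text \<open>
  Every cell, including the vertices, gets an independent coin; a cell is present if and only
  if its own coin and the coins of all its faces succeed.  Thus, given that all proper faces
  of \<open>\<sigma>\<close> are present, \<open>\<sigma>\<close> is present with probability \<open>p \<sigma>\<close>.  The vertex \<open>i\<close> is the cell
  \<open>{i}\<close>.
\<close>

definition max_random_complex :: "nat \<Rightarrow> (nat set \<Rightarrow> real) \<Rightarrow> nat set set pmf" where
  "max_random_complex N p =
     map_pmf (\<lambda>coin. {\<sigma>\<in>full_simplex N. \<forall>\<tau>. \<tau> \<subseteq> \<sigma> \<and> \<tau> \<noteq> {} \<longrightarrow> coin \<tau>})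
       (Pi_pmf (full_simplex N) False (\<lambda>\<sigma>. bernoulli_pmf (p \<sigma>)))"


section \<open>Polynomials in the cell probabilities\<close>

text \<open>
  Integer polynomials in the indeterminates \<open>p\<^sub>\<sigma>\<close>, as finitely supported coefficient
  functions on monomials.  The multiplication on this type is polynomial multiplication, so
  equality is equality after expanding and collecting terms.
\<close>

type_synonym cell_poly = "(nat set \<Rightarrow>\<^sub>0 nat) \<Rightarrow>\<^sub>0 int"

definition cell_var :: "nat set \<Rightarrow> cell_poly" where
  "cell_var \<sigma> = Poly_Mapping.single (Poly_Mapping.single \<sigma> 1) 1"

definition eval_poly :: "(nat set \<Rightarrow> real) \<Rightarrow> cell_poly \<Rightarrow> real" where
  "eval_poly p P =
     (\<Sum>m\<in>Poly_Mapping.keys P. of_int (Poly_Mapping.lookup P m) *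
        (\<Prod>\<sigma>\<in>Poly_Mapping.keys m. p \<sigma> ^ Poly_Mapping.lookup m \<sigma>))"

text \<open>
  The probability of the realization \<open>\<Delta>\<close>: the cells of \<open>\<Delta>\<close> are present, and the absent
  cells all of whose proper faces are in \<open>\<Delta>\<close> (including all absent vertices) were rejected.
\<close>

definition realization_poly :: "nat \<Rightarrow> nat set set \<Rightarrow> cell_poly" where
  "realization_poly N \<Delta> =
     (\<Prod>\<sigma>\<in>\<Delta>. cell_var \<sigma>) *
     (\<Prod>\<sigma> | \<sigma> \<in> full_simplex N - \<Delta> \<and> (\<forall>\<tau>. \<tau> \<subset> \<sigma> \<and> \<tau> \<noteq> {} \<longrightarrow> \<tau> \<in> \<Delta>). 1 - cell_var \<sigma>)"

definition expected_betti_poly :: "'k::field itself \<Rightarrow> nat \<Rightarrow> nat \<Rightarrow> cell_poly" where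
  "expected_betti_poly K N n =
     (\<Sum>\<Delta>\<in>subcomplexes N. of_nat (betti K n \<Delta>) * realization_poly N \<Delta>)"

definition mon :: "nat set set \<Rightarrow> cell_poly" where
  "mon \<Gamma> = (\<Prod>\<sigma>\<in>\<Gamma>. cell_var \<sigma>)"

text \<open>A complex generated by a set \<open>F\<close> of \<open>k\<close>-cells has exactly \<open>F\<close> as its \<open>k\<close>-cells.\<close>

definition c_coeff :: "'k::field itself \<Rightarrow> nat \<Rightarrow> nat set set \<Rightarrow> int" where
  "c_coeff K k \<Gamma> =
     (if betti K k \<Gamma> = 0 then 0
      else \<Sum>S\<in>Pow (kcells k \<Gamma>). (-1) ^ card S * int (betti K k (\<Gamma> - S)))"

definition pE_poly :: "'k::field itself \<Rightarrow> nat \<Rightarrow> nat \<Rightarrow> cell_poly" where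
  "pE_poly K N k =
     (if k = 0 then \<Sum>i=1..N. cell_var {i}
      else \<Sum>\<Gamma> \<in> generated_complex ` (Pow (kcells k (full_simplex N)) - {{}}).
             of_int (c_coeff K k \<Gamma>) * mon \<Gamma>)"

definition d_poly :: "nat \<Rightarrow> nat \<Rightarrow> cell_poly" where
  "d_poly N k = (\<Sum>\<sigma>\<in>kcells k (full_simplex N). mon (generated_complex {\<sigma>}))"

end

theory Submission
  imports Defs
begin

text \<open>
  Let \<open>z\<^sub>k(F)\<close> be the dimension of the space of \<open>k\<close>-cycles supported on a set \<open>F\<close> of \<open>k\<close>-cells.  It
  depends on \<open>F\<close> alone, not on the complex around it.  Since boundaries are cycles, rank-nullity
  for the boundary map in degree \<open>n + 1\<close> gives, for every complex,
  \<open>b\<^sub>n = z\<^sub>n - f\<^sub>n\<^sub>+\<^sub>1 + z\<^sub>n\<^sub>+\<^sub>1\<close>,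
  where \<open>f\<^sub>k\<close> counts the \<open>k\<close>-cells (\<open>betti_eq_cycle_ranks\<close>).  The cell count is subtracted in
  every degree, whatever the parity of \<open>n\<close>: the rank of the boundary map is
  \<open>f\<^sub>n\<^sub>+\<^sub>1 - z\<^sub>n\<^sub>+\<^sub>1\<close>, and it is this rank that \<open>b\<^sub>n\<close> loses against \<open>z\<^sub>n\<close>.

  It remains to take expectations of the three terms.  The probability that a fixed complex
  \<open>\<Gamma>\<close> is contained in the random complex is \<open>mon \<Gamma>\<close>, and this holds already as an identity of
  polynomials (\<open>sum_realization_poly_above\<close>).  So the expectation is immediate for every
  function of the complex that is written as a sum over the sets of \<open>k\<close>-cells it contains.
  For \<open>f\<^sub>k\<close> these are the single cells, and the result is \<open>d\<^sub>k\<close>.  For \<open>z\<^sub>k\<close> Moebius inversion over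
  the sets of \<open>k\<close>-cells provides the coefficients, and they are the numbers \<open>c\<^sub>k\<close>: the complex
  \<open>\<Gamma> - S\<close> has no cells above dimension \<open>k\<close>, so its Betti number is a value of \<open>z\<^sub>k\<close>
  (\<open>c_coeff_generated\<close>, \<open>sum_cycle_rank_moebius\<close>).  For \<open>k = 0\<close> every chain is a cycle,
  \<open>z\<^sub>0 = f\<^sub>0\<close>, and the expectation is the sum of the vertex probabilities.

  The probabilistic half rests on one description of the event that the random complex is
  \<open>\<Delta>\<close>: all coins of \<open>\<Delta>\<close> succeed and all coins of its minimal missing cells fail
  (\<open>surviving_eq_iff\<close>).  Independence turns it into the value of \<open>realization_poly N \<Delta>\<close>.
\<close>

section \<open>Linear algebra\<close>

lemma poly_mapping_sum_singles:
  "P = (\<Sum>m\<in>Poly_Mapping.keys P. Poly_Mapping.single m (Poly_Mapping.lookup P m))"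
proof (rule poly_mapping_eqI)
  fix m
  have "(\<Sum>m'\<in>Poly_Mapping.keys P. Poly_Mapping.lookup P m' when m' = m) 
      = (\<Sum>m'\<in>Poly_Mapping.keys P. if m' = m then Poly_Mapping.lookup P m' else 0)"
    by (rule sum.cong) auto
  then show "Poly_Mapping.lookup P m = Poly_Mapping.lookup
      (\<Sum>m\<in>Poly_Mapping.keys P. Poly_Mapping.single m (Poly_Mapping.lookup P m)) m"
    by (simp add: lookup_sum lookup_single in_keys_iff)
qed

text \<open>
  Chains form an infinite-dimensional space as a type, so the theorem is needed on a subspace
  that is contained in the span of a finite set.  A basis \<open>B\<close> of the kernel extends to a basis
  \<open>C\<close> of \<open>V\<close>, and \<open>f\<close> maps \<open>C - B\<close> bijectively to a basis of the image.
\<close>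

lemma rank_nullity:
  assumes lin: "Vector_Spaces.linear s1 s2 f"
    and V: "module.subspace s1 V" and E: "finite E" "V \<subseteq> module.span s1 E"
  shows "vector_space.dim s1 V
    = vector_space.dim s1 {x \<in> V. f x = 0} + vector_space.dim s2 (f ` V)"
proof -
  interpret f: Vector_Spaces.linear s1 s2 f by fact
  let ?K = "{x \<in> V. f x = 0}"
  obtain B where B: "B \<subseteq> ?K" "f.vs1.independent B" "?K \<subseteq> f.vs1.span B"
    using f.vs1.maximal_independent_subset by blast
  obtain C where C: "B \<subseteq> C" "C \<subseteq> V" "f.vs1.independent C" "V \<subseteq> f.vs1.span C"
    using f.vs1.maximal_independent_subset_extend[of B V] B by blast
  have fC: "finite C"
    using f.vs1.independent_span_bound[OF E(1) C(3)] C(2) E(2) by blast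
  have D_sub: "f.vs1.span (C - B) \<subseteq> V"
    using C(2) V by (intro f.vs1.span_minimal) auto
  have inj: "inj_on f (f.vs1.span (C - B))"
    unfolding f.inj_on_iff_eq_0[OF f.vs1.subspace_span]
  proof (intro ballI impI)
    fix x assume x: "x \<in> f.vs1.span (C - B)" "f x = 0"
    then have xB: "x \<in> f.vs1.span B" using D_sub B(3) by blast
    \<comment> \<open>Both expansions of \<open>x\<close> are its unique expansion in \<open>C\<close>, with supports in disjoint sets.\<close>
    have "f.vs1.representation C x = f.vs1.representation B x"
      using f.vs1.representation_extend[OF C(3) xB C(1)] .
    moreover have "f.vs1.representation C x = f.vs1.representation (C - B) x"
      using f.vs1.representation_extend[OF C(3) x(1)] by blast
    ultimately have "f.vs1.representation C x b = 0" for b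
      using f.vs1.representation_ne_zero by (metis DiffD2)
    moreover have "x \<in> f.vs1.span C" using x(1) D_sub C(4) by blast
    ultimately show "x = 0"
      using f.vs1.sum_nonzero_representation_eq[OF C(3), of x] by simp
  qed
  have ind: "f.vs2.independent (f ` (C - B))"
    using f.independent_injective_image inj C(3) f.vs1.dependent_mono
    by (metis Diff_subset)
  have image: "f ` V = f.vs2.span (f ` (C - B))"
  proof
    show "f.vs2.span (f ` (C - B)) \<subseteq> f ` V"
      unfolding f.span_image using D_sub by blast
    have "f ` V \<subseteq> f.vs2.span (f ` C)"
      unfolding f.span_image using C(4) by blast
    also have "\<dots> \<subseteq> f.vs2.span (f ` (C - B))"
    proof (rule f.vs2.span_minimal[OF _ f.vs2.subspace_span], rule image_subsetI)
      fix x assume "x \<in> C"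
      then show "f x \<in> f.vs2.span (f ` (C - B))"
        using B(1) f.vs2.span_zero f.vs2.span_base by (cases "x \<in> B") auto
    qed
    finally show "f ` V \<subseteq> f.vs2.span (f ` (C - B))" .
  qed
  have "f.vs2.dim (f ` V) = card (f ` (C - B))"
    unfolding image by (rule f.vs2.dim_span_eq_card_independent[OF ind])
  also have "\<dots> = card (C - B)"
    using inj_on_subset[OF inj f.vs1.span_superset] by (rule card_image)
  also have "\<dots> = card C - card B"
    using fC C(1) by (simp add: card_Diff_subset finite_subset)
  finally have "f.vs2.dim (f ` V) = card C - card B" .
  moreover have "f.vs1.dim V = card C"
    using f.vs1.basis_card_eq_dim[OF C(2,4,3)] by simp
  moreover have "f.vs1.dim ?K = card B"
    using f.vs1.basis_card_eq_dim[OF B(1,3,2)] by simp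
  moreover have "card B \<le> card C" using fC C(1) by (rule card_mono)
  ultimately show ?thesis by simp
qed

lemma (in vector_space) dim_mono_of_finite_span:
  assumes "U \<subseteq> W" "finite E" "W \<subseteq> span E"
  shows "dim U \<le> dim W"
proof -
  obtain C where C: "C \<subseteq> W" "independent C" "W \<subseteq> span C" "card C = dim W"
    using basis_exists by blast
  have "finite C"
    using independent_span_bound[OF assms(2) C(2)] C(1) assms(3) by blast
  then show ?thesis using dim_le_card[of U C] assms(1) C by auto
qed

section \<open>Cycles on a set of cells\<close>

definition chains_on :: "nat set set \<Rightarrow> (nat set \<Rightarrow>\<^sub>0 'k::field) set" where
  "chains_on F = {c. Poly_Mapping.keys c \<subseteq> F}"

text \<open>
  With a set of cells in place of a complex as parameter, removing cells and summing over
  subsets of cells need no reference to faces.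
\<close>

definition cycles_on :: "nat \<Rightarrow> nat set set \<Rightarrow> (nat set \<Rightarrow>\<^sub>0 'k::field) set" where
  "cycles_on k F = {c \<in> chains_on F. boundary k c = 0}"

definition cycle_rank :: "'k::field itself \<Rightarrow> nat \<Rightarrow> nat set set \<Rightarrow> nat" where
  "cycle_rank K k F = chain.dim (cycles_on k F :: (nat set \<Rightarrow>\<^sub>0 'k) set)"

lemma chains_conv_chains_on: "chains n \<Delta> = chains_on (kcells n \<Delta>)"
  by (simp add: chains_def chains_on_def)

lemma cycles_conv_cycles_on: "cycles n \<Delta> = cycles_on n (kcells n \<Delta>)"
  by (simp add: cycles_def cycles_on_def chains_conv_chains_on)

text \<open>
  A common index set for several chains makes linearity of the boundary visible.
\<close>

lemma boundary_extend:
  assumes "finite A" "Poly_Mapping.keys c \<subseteq> A" "n \<noteq> 0"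
  shows "boundary n c = (\<Sum>\<sigma>\<in>A. chain_scale (Poly_Mapping.lookup c \<sigma>) (cell_boundary \<sigma>))"
  using assms by (auto simp: boundary_def in_keys_iff intro!: sum.mono_neutral_left)

lemma linear_boundary: 
  "Vector_Spaces.linear chain_scale chain_scale (boundary n :: (nat set \<Rightarrow>\<^sub>0 'k::field) \<Rightarrow> _)"
proof -
  have add: "boundary n (x + y) = boundary n x + boundary n y" for x y :: "nat set \<Rightarrow>\<^sub>0 'k"
  proof (cases "n = 0")
    case False
    let ?A = "Poly_Mapping.keys x \<union> Poly_Mapping.keys y"
    show ?thesis
      using False Poly_Mapping.keys_add[of x y]
      by (simp add: boundary_extend[of ?A] lookup_add chain.scale_left_distrib sum.distrib)
  qed (simp add: boundary_def)
  have scale: "boundary n (chain_scale r x) = chain_scale r (boundary n x)"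
    for r and x :: "nat set \<Rightarrow>\<^sub>0 'k"
  proof (cases "n = 0")
    case False
    have "Poly_Mapping.keys (chain_scale r x) \<subseteq> Poly_Mapping.keys x"
      by (auto simp: in_keys_iff lookup_chain_scale)
    then show ?thesis
      using False
      by (simp add: boundary_extend[of "Poly_Mapping.keys x"] lookup_chain_scale chain.scale_sum_right)
  qed (simp add: boundary_def)
  show ?thesis
    unfolding Vector_Spaces.linear_iff using add scale chain.vector_space_axioms by blast
qed

lemma boundary_single:
  "n \<noteq> 0 \<Longrightarrow> boundary n (Poly_Mapping.single \<sigma> a) = chain_scale a (cell_boundary \<sigma>)"
  by (cases "a = 0") (auto simp: boundary_extend[of "{\<sigma>}"])

lemma subspace_chains_on: "chain.subspace (chains_on F :: (nat set \<Rightarrow>\<^sub>0 'k::field) set)"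
  unfolding chain.subspace_def chains_on_def
  by (auto simp: subset_iff in_keys_iff lookup_add lookup_chain_scale) (metis add.right_neutral)

lemma chain_scale_single:
  "chain_scale a (Poly_Mapping.single \<tau> b) = Poly_Mapping.single \<tau> (a * b)"
  by (rule poly_mapping_eqI) (simp add: lookup_chain_scale lookup_single mult_when)

lemma chains_on_subset_span:
  "chains_on F \<subseteq> chain.span ((\<lambda>\<sigma>. Poly_Mapping.single \<sigma> (1::'k::field)) ` F)"
proof
  fix c :: "nat set \<Rightarrow>\<^sub>0 'k" assume c: "c \<in> chains_on F"
  have "c = (\<Sum>\<sigma>\<in>Poly_Mapping.keys c.
      chain_scale (Poly_Mapping.lookup c \<sigma>) (Poly_Mapping.single \<sigma> 1))"
    by (subst poly_mapping_sum_singles) (simp add: chain_scale_single)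
  also have "\<dots> \<in> chain.span ((\<lambda>\<sigma>. Poly_Mapping.single \<sigma> 1) ` F)"
    using c by (intro chain.span_sum chain.span_scale chain.span_base imageI)
      (auto simp: chains_on_def)
  finally show "c \<in> chain.span ((\<lambda>\<sigma>. Poly_Mapping.single \<sigma> 1) ` F)" .
qed

lemma dim_chains_on:
  assumes "finite F"
  shows "chain.dim (chains_on F :: (nat set \<Rightarrow>\<^sub>0 'k::field) set) = card F"
proof -
  let ?e = "\<lambda>\<sigma>. Poly_Mapping.single \<sigma> (1::'k)"
  have inj: "inj_on ?e F"
    by (rule inj_onI) (metis lookup_single_eq lookup_single_not_eq one_neq_zero)
  have "chain.independent (?e ` F)"
  proof (rule chain.independent_if_scalars_zero)
    fix f x assume sum: "(\<Sum>x\<in>?e ` F. chain_scale (f x) x) = 0" and x: "x \<in> ?e ` F"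
    then obtain \<tau> where \<tau>: "\<tau> \<in> F" "x = ?e \<tau>" by blast
    have "0 = Poly_Mapping.lookup (\<Sum>x\<in>?e ` F. chain_scale (f x) x) \<tau>" by (simp add: sum)
    also have "\<dots> = (\<Sum>\<sigma>\<in>F. f (?e \<sigma>) * (1 when \<sigma> = \<tau>))"
      by (simp add: sum.reindex[OF inj] lookup_sum lookup_chain_scale lookup_single)
    also have "\<dots> = (\<Sum>\<sigma>\<in>F. if \<sigma> = \<tau> then f (?e \<sigma>) else 0)" by (rule sum.cong) auto
    finally show "f x = 0" using \<tau> assms by simp
  qed (use assms in simp)
  then have "chain.dim (chains_on F :: (nat set \<Rightarrow>\<^sub>0 'k) set) = card (?e ` F)"
    by (intro chain.dim_unique[of "?e ` F"])
      (auto intro: chains_on_subset_span[THEN subsetD] simp: chains_on_def)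
  then show ?thesis by (simp add: card_image[OF inj])
qed

lemma cycle_rank_plus_dim_boundary:
  assumes "finite F"
  shows "cycle_rank TYPE('k::field) k F
     + chain.dim (boundary k ` chains_on F :: (nat set \<Rightarrow>\<^sub>0 'k) set) = card F"
  using rank_nullity[OF linear_boundary[of k, where 'k='k] subspace_chains_on[of F] finite_imageI[OF assms] chains_on_subset_span]
  by (simp add: cycle_rank_def cycles_on_def dim_chains_on[OF assms])

lemma cycle_rank_mono:
  assumes "finite F" "G \<subseteq> F"
  shows "cycle_rank K k G \<le> cycle_rank K k F"
  unfolding cycle_rank_def
  by (rule chain.dim_mono_of_finite_span[OF _ finite_imageI[OF assms(1)]
        order_trans[OF _ chains_on_subset_span]])
    (use assms(2) in \<open>auto simp: cycles_on_def chains_on_def\<close>)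

lemma cycle_rank_empty: "cycle_rank TYPE('k::field) k {} = 0"
  using cycle_rank_plus_dim_boundary[of "{}" k, where 'k='k] by simp

lemma cycle_rank_zero: "finite F \<Longrightarrow> cycle_rank TYPE('k::field) 0 F = card F"
  using dim_chains_on[of F, where 'k='k]
  by (simp add: cycle_rank_def cycles_on_def boundary_def)

section \<open>The boundary of a boundary\<close>

text \<open>
  Each face of codimension two arises twice, by deleting \<open>v\<close> and then \<open>w\<close> or conversely.
  Deleting the smaller vertex first moves the larger one down by one position, so the two
  contributions have opposite signs.  They are matched in pairs, since in characteristic two
  the antisymmetry of the summand alone would not make the sum vanish.
\<close>

lemma boundary_cell_boundary:
  fixes \<sigma> :: "nat set"
  assumes "finite \<sigma>"
  shows "boundary n (cell_boundary \<sigma> :: nat set \<Rightarrow>\<^sub>0 'k::field) = 0"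
proof (cases "n = 0")
  case False
  interpret bd: Vector_Spaces.linear chain_scale chain_scale "boundary n :: (nat set \<Rightarrow>\<^sub>0 'k) \<Rightarrow> _"
    by (rule linear_boundary)
  define s where "s v \<tau> = (-1 :: 'k) ^ card {w\<in>\<tau>. w < v}" for v :: nat and \<tau>
  \<comment> \<open>The contribution of deleting \<open>v\<close> first and \<open>w\<close> second.\<close>
  define t where "t v w = Poly_Mapping.single (\<sigma> - {v, w}) (s v \<sigma> * s w (\<sigma> - {v}))" for v w
  have swap: "t v w = - t w v" if "v \<in> \<sigma>" "w \<in> \<sigma>" "v < w" for v w
  proof -
    have "{u \<in> \<sigma>. u < w} = insert v {u \<in> \<sigma> - {v}. u < w}" using that by auto
    then have "s w \<sigma> = - s w (\<sigma> - {v})" using assms by (simp add: s_def)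
    moreover have "{u \<in> \<sigma> - {w}. u < v} = {u \<in> \<sigma>. u < v}" using that by auto
    then have "s v (\<sigma> - {w}) = s v \<sigma>" by (simp add: s_def)
    ultimately show ?thesis
      by (simp add: t_def insert_commute mult.commute flip: single_uminus)
  qed
  define L where "L = {(v, w). v \<in> \<sigma> \<and> w \<in> \<sigma> \<and> v < w}"
  have finL: "finite L"
    by (rule finite_subset[of _ "\<sigma> \<times> \<sigma>"]) (use assms in \<open>auto simp: L_def\<close>)
  have "boundary n (cell_boundary \<sigma> :: nat set \<Rightarrow>\<^sub>0 'k)
      = (\<Sum>v\<in>\<sigma>. chain_scale (s v \<sigma>) (cell_boundary (\<sigma> - {v})))"
    using False by (simp add: cell_boundary_def[of \<sigma>] bd.sum boundary_single s_def)
  also have "\<dots> = (\<Sum>v\<in>\<sigma>. \<Sum>w\<in>\<sigma> - {v}. t v w)"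
  proof (rule sum.cong[OF refl])
    fix v
    have "\<sigma> - {v} - {w} = \<sigma> - {v, w}" for w by auto
    then show "chain_scale (s v \<sigma>) (cell_boundary (\<sigma> - {v})) = (\<Sum>w\<in>\<sigma> - {v}. t v w)"
      by (simp only: cell_boundary_def[of "\<sigma> - {v}"] chain.scale_sum_right chain_scale_single t_def s_def)
  qed
  also have "\<dots> = (\<Sum>(v, w)\<in>Sigma \<sigma> (\<lambda>v. \<sigma> - {v}). t v w)"
    using assms by (intro sum.Sigma) auto
  also have "Sigma \<sigma> (\<lambda>v. \<sigma> - {v}) = L \<union> prod.swap ` L" 
    by (auto simp: L_def image_iff)
  also have "(\<Sum>(v, w)\<in>L \<union> prod.swap ` L. t v w)
      = (\<Sum>(v, w)\<in>L. t v w) + (\<Sum>(v, w)\<in>prod.swap ` L. t v w)"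
    using finL by (intro sum.union_disjoint) (auto simp: L_def)
  also have "(\<Sum>(v, w)\<in>prod.swap ` L. t v w) = (\<Sum>(v, w)\<in>L. t w v)"
    by (subst sum.reindex) (auto simp: split_def)
  also have "(\<Sum>(v, w)\<in>L. t v w) = (\<Sum>(v, w)\<in>L. - t w v)"
    by (intro sum.cong) (auto simp: L_def swap)
  finally show ?thesis by (simp add: split_def sum_negf)
qed (simp add: boundary_def)

section \<open>Betti numbers from cycle ranks\<close>

lemma betti_eq_cycle_rank_minus:
  "betti TYPE('k::field) n \<Delta> = cycle_rank TYPE('k) n (kcells n \<Delta>)
     - chain.dim (boundary (n + 1) ` chains_on (kcells (n + 1) \<Delta>) :: (nat set \<Rightarrow>\<^sub>0 'k) set)"
  by (simp add: betti_def cycle_rank_def boundaries_def cycles_conv_cycles_on chains_conv_chains_on)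

text \<open>
  The subtraction of natural numbers in the Betti number is exact because of this inclusion.
\<close>

lemma boundaries_subset_cycles:
  assumes \<Delta>: "\<Delta> \<in> subcomplexes N"
  shows "boundaries n \<Delta> \<subseteq> (cycles n \<Delta> :: (nat set \<Rightarrow>\<^sub>0 'k::field) set)"
proof -
  let ?F = "kcells (n + 1) \<Delta>"
  have fin: "finite \<sigma>" if "\<sigma> \<in> ?F" for \<sigma>
    using that card.infinite[of \<sigma>] by (auto simp: kcells_def)
  interpret bd: Vector_Spaces.linear chain_scale chain_scale "boundary n :: (nat set \<Rightarrow>\<^sub>0 'k) \<Rightarrow> _"
    by (rule linear_boundary)
  have cell: "cell_boundary \<sigma> \<in> (chains n \<Delta> :: (nat set \<Rightarrow>\<^sub>0 'k) set)" if \<sigma>: "\<sigma> \<in> ?F" for \<sigma>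
    unfolding chains_conv_chains_on cell_boundary_def
  proof (rule chain.subspace_sum[OF subspace_chains_on])
    fix v assume v: "v \<in> \<sigma>"
    have card: "card (\<sigma> - {v}) = n + 1" using \<sigma> v fin[OF \<sigma>] by (simp add: kcells_def)
    then have "\<sigma> - {v} \<noteq> {}" by (metis add_is_0 card.empty one_neq_zero)
    moreover have "\<sigma> \<in> \<Delta>" using \<sigma> by (simp add: kcells_def)
    ultimately have "\<sigma> - {v} \<in> \<Delta>"
      using \<Delta> unfolding subcomplexes_def by (metis (mono_tags, lifting) Diff_subset mem_Collect_eq)
    with card have "\<sigma> - {v} \<in> kcells n \<Delta>" by (simp add: kcells_def)
    then show "Poly_Mapping.single (\<sigma> - {v}) ((- 1) ^ card {w \<in> \<sigma>. w < v}) \<in> chains_on (kcells n \<Delta>)"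
      by (simp add: chains_on_def)
  qed
  have "boundary (n + 1) c \<in> cycles n \<Delta>" if "c \<in> chains (n + 1) \<Delta>" for c :: "nat set \<Rightarrow>\<^sub>0 'k"
  proof -
    have keys: "\<sigma> \<in> ?F" if "\<sigma> \<in> Poly_Mapping.keys c" for \<sigma>
      using that \<open>c \<in> _\<close> by (auto simp: chains_def)
    have "boundary (n + 1) c \<in> chains n \<Delta>"
      using cell keys subspace_chains_on unfolding boundary_def chains_conv_chains_on
      by (auto intro!: chain.subspace_sum chain.subspace_scale)
    moreover have "boundary n (boundary (n + 1) c) = 0"
      unfolding boundary_def[of "n + 1"] using keys fin
      by (simp add: bd.sum bd.scale boundary_cell_boundary)
    ultimately show ?thesis by (simp add: cycles_def)
  qed
  then show ?thesis by (auto simp: boundaries_def)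
qed

lemma finite_full_simplex [simp]: "finite (full_simplex N)"
  by (simp add: full_simplex_def)

text \<open>
  Rank-nullity in degree \<open>n + 1\<close> replaces the dimension of the boundaries by
  \<open>f\<^sub>n\<^sub>+\<^sub>1 - z\<^sub>n\<^sub>+\<^sub>1\<close>.
\<close>

lemma betti_eq_cycle_ranks:
  assumes \<Delta>: "\<Delta> \<in> subcomplexes N"
  shows "int (betti TYPE('k::field) n \<Delta>) = int (cycle_rank TYPE('k) n (kcells n \<Delta>))
     - int (card (kcells (n + 1) \<Delta>)) + int (cycle_rank TYPE('k) (n + 1) (kcells (n + 1) \<Delta>))"
proof -
  have "finite \<Delta>"
    using \<Delta> finite_subset[OF _ finite_full_simplex] by (auto simp: subcomplexes_def)
  then have fin: "finite (kcells k \<Delta>)" for k by (simp add: kcells_def)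
  have "chain.dim (boundaries n \<Delta> :: (nat set \<Rightarrow>\<^sub>0 'k) set) \<le> chain.dim (cycles n \<Delta> :: (nat set \<Rightarrow>\<^sub>0 'k) set)"
    by (rule chain.dim_mono_of_finite_span[OF boundaries_subset_cycles[OF \<Delta>]
          finite_imageI[OF fin[of n]] order_trans[OF _ chains_on_subset_span]])
      (auto simp: cycles_def chains_conv_chains_on)
  then show ?thesis
    using cycle_rank_plus_dim_boundary[OF fin[of "n + 1"], of "n + 1", where 'k='k]
    by (simp add: betti_def cycle_rank_def boundaries_def cycles_conv_cycles_on chains_conv_chains_on)
qed

section \<open>Evaluation of polynomials\<close>

definition eval_monomial :: "(nat set \<Rightarrow> real) \<Rightarrow> (nat set \<Rightarrow>\<^sub>0 nat) \<Rightarrow> real" where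
  "eval_monomial p m = (\<Prod>\<sigma>\<in>Poly_Mapping.keys m. p \<sigma> ^ Poly_Mapping.lookup m \<sigma>)"

lemma eval_monomial_extend:
  assumes "finite A" "Poly_Mapping.keys m \<subseteq> A"
  shows "eval_monomial p m = (\<Prod>\<sigma>\<in>A. p \<sigma> ^ Poly_Mapping.lookup m \<sigma>)"
  unfolding eval_monomial_def using assms
  by (intro prod.mono_neutral_left) (auto simp: in_keys_iff)

lemma eval_monomial_add: "eval_monomial p (m + m') = eval_monomial p m * eval_monomial p m'"
  using Poly_Mapping.keys_add[of m m']
  by (simp add: eval_monomial_extend[of "Poly_Mapping.keys m \<union> Poly_Mapping.keys m'"]
      lookup_add power_add prod.distrib)

lemma eval_poly_extend:
  assumes "finite A" "Poly_Mapping.keys P \<subseteq> A"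
  shows "eval_poly p P = (\<Sum>m\<in>A. of_int (Poly_Mapping.lookup P m) * eval_monomial p m)"
  unfolding eval_poly_def eval_monomial_def[symmetric] using assms
  by (intro sum.mono_neutral_left) (auto simp: in_keys_iff)

lemma eval_poly_add: "eval_poly p (P + Q) = eval_poly p P + eval_poly p Q"
  using Poly_Mapping.keys_add[of P Q]
  by (simp add: eval_poly_extend[of "Poly_Mapping.keys P \<union> Poly_Mapping.keys Q"]
      lookup_add distrib_right sum.distrib)

lemma eval_poly_zero: "eval_poly p 0 = 0"
  by (simp add: eval_poly_def)

lemma eval_poly_sum: "eval_poly p (\<Sum>i\<in>I. f i) = (\<Sum>i\<in>I. eval_poly p (f i))"
  by (induction I rule: infinite_finite_induct) (auto simp: eval_poly_add eval_poly_zero)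

lemma eval_poly_single: "eval_poly p (Poly_Mapping.single m a) = of_int a * eval_monomial p m"
  by (cases "a = 0") (auto simp: eval_poly_extend[of "{m}"])

text \<open>
  By bilinearity it suffices to multiply monomials.
\<close>

lemma eval_poly_mult: "eval_poly p (P * Q) = eval_poly p P * eval_poly p Q"
proof -
  have single: "eval_poly p (Poly_Mapping.single m a * Poly_Mapping.single m' b)
    = eval_poly p (Poly_Mapping.single m a) * eval_poly p (Poly_Mapping.single m' b)" for m m' a b
    by (simp add: mult_single eval_poly_single eval_monomial_add)
  have sum: "eval_poly p (sum f A * sum g B) = eval_poly p (sum f A) * eval_poly p (sum g B)"
    if "\<And>a b. eval_poly p (f a * g b) = eval_poly p (f a) * eval_poly p (g b)"
    for f g :: "_ \<Rightarrow> cell_poly" and A B :: "(nat set \<Rightarrow>\<^sub>0 nat) set"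
    by (simp add: sum_product eval_poly_sum that)
  show ?thesis
    using sum[of "\<lambda>m. Poly_Mapping.single m (Poly_Mapping.lookup P m)"
        "\<lambda>m. Poly_Mapping.single m (Poly_Mapping.lookup Q m)"
        "Poly_Mapping.keys P" "Poly_Mapping.keys Q", OF single]
    by (simp flip: poly_mapping_sum_singles)
qed

lemma eval_poly_of_nat: "eval_poly p (of_nat a) = of_nat a"
  using eval_poly_single[of p 0 "int a"] by (simp add: eval_monomial_def)

lemma eval_poly_one: "eval_poly p 1 = 1"
  using eval_poly_of_nat[of p 1] by simp

lemma eval_poly_prod: "eval_poly p (\<Prod>i\<in>I. f i) = (\<Prod>i\<in>I. eval_poly p (f i))"
  by (induction I rule: infinite_finite_induct) (auto simp: eval_poly_mult eval_poly_one)

lemma eval_poly_cell_var: "eval_poly p (cell_var \<sigma>) = p \<sigma>"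
  by (simp add: cell_var_def eval_poly_single eval_monomial_def)

lemma eval_poly_one_minus: "eval_poly p (1 - P) = 1 - eval_poly p P"
  using eval_poly_add[of p "1 - P" P] by (simp add: eval_poly_one)

section \<open>Coins and realizations\<close>

text \<open>
  The complex that results when \<open>A\<close> is the set of cells whose coins succeed.
\<close>

definition surviving :: "nat \<Rightarrow> nat set set \<Rightarrow> nat set set" where
  "surviving N A = {\<sigma>\<in>full_simplex N. \<forall>\<tau>. \<tau> \<subseteq> \<sigma> \<and> \<tau> \<noteq> {} \<longrightarrow> \<tau> \<in> A}"

text \<open>
  The minimal missing cells of \<open>\<Delta>\<close>: those whose coins were decisive for their absence.
\<close>

definition rejected :: "nat \<Rightarrow> nat set set \<Rightarrow> nat set set" where
  "rejected N \<Delta> = {\<sigma>. \<sigma> \<in> full_simplex N - \<Delta> \<and> (\<forall>\<tau>. \<tau> \<subset> \<sigma> \<and> \<tau> \<noteq> {} \<longrightarrow> \<tau> \<in> \<Delta>)}"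

lemma full_simplex_face: "\<lbrakk>\<sigma> \<in> full_simplex N; \<tau> \<subseteq> \<sigma>; \<tau> \<noteq> {}\<rbrakk> \<Longrightarrow> \<tau> \<in> full_simplex N"
  by (auto simp: full_simplex_def)

lemma finite_subcomplexes: "finite (subcomplexes N)"
  by (rule finite_subset[of _ "Pow (full_simplex N)"]) (auto simp: subcomplexes_def)

lemma subcomplexes_subset: "\<Delta> \<in> subcomplexes N \<Longrightarrow> \<Delta> \<subseteq> full_simplex N"
  by (simp add: subcomplexes_def)

lemma subcomplexes_face: "\<lbrakk>\<Delta> \<in> subcomplexes N; \<sigma> \<in> \<Delta>; \<tau> \<subseteq> \<sigma>; \<tau> \<noteq> {}\<rbrakk> \<Longrightarrow> \<tau> \<in> \<Delta>"
  unfolding subcomplexes_def by blast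

lemma surviving_in_subcomplexes: "surviving N A \<in> subcomplexes N"
  unfolding subcomplexes_def surviving_def using full_simplex_face by blast

lemma subset_surviving_iff:
  assumes "\<Gamma> \<in> subcomplexes N"
  shows "\<Gamma> \<subseteq> surviving N A \<longleftrightarrow> \<Gamma> \<subseteq> A"
proof
  assume "\<Gamma> \<subseteq> surviving N A"
  then show "\<Gamma> \<subseteq> A" by (auto simp: surviving_def full_simplex_def)
next
  assume "\<Gamma> \<subseteq> A"
  then show "\<Gamma> \<subseteq> surviving N A"
    using subcomplexes_subset[OF assms] subcomplexes_face[OF assms]
    by (auto simp: surviving_def)
qed

text \<open>
  Every missing cell has a minimal missing face, so the failure of the minimal ones already
  keeps out everything beyond \<open>\<Delta>\<close>.
\<close>

lemma surviving_eq_iff: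
  assumes \<Delta>: "\<Delta> \<in> subcomplexes N"
  shows "surviving N A = \<Delta> \<longleftrightarrow> \<Delta> \<subseteq> A \<and> A \<inter> rejected N \<Delta> = {}"
proof
  assume eq: "surviving N A = \<Delta>"
  have "\<Delta> \<subseteq> A" using subset_surviving_iff[OF \<Delta>, of A] eq by simp
  moreover have "\<sigma> \<notin> A" if "\<sigma> \<in> rejected N \<Delta>" for \<sigma>
  proof
    assume "\<sigma> \<in> A"
    then have "\<sigma> \<in> surviving N A"
      using that \<open>\<Delta> \<subseteq> A\<close> by (auto simp: rejected_def surviving_def)
    then show False using that eq by (simp add: rejected_def)
  qed
  ultimately show "\<Delta> \<subseteq> A \<and> A \<inter> rejected N \<Delta> = {}" by blast
next
  assume A: "\<Delta> \<subseteq> A \<and> A \<inter> rejected N \<Delta> = {}"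
  have "\<sigma> \<in> \<Delta>" if \<sigma>: "\<sigma> \<in> surviving N A" for \<sigma>
  proof (rule ccontr)
    assume "\<sigma> \<notin> \<Delta>"
    define M where "M = {\<tau>. \<tau> \<subseteq> \<sigma> \<and> \<tau> \<noteq> {} \<and> \<tau> \<notin> \<Delta>}"
    have full: "\<sigma> \<in> full_simplex N" using \<sigma> by (simp add: surviving_def)
    then have "finite \<sigma>" "\<sigma> \<noteq> {}" by (auto simp: full_simplex_def intro: finite_subset)
    then have "finite M" "M \<noteq> {}" using \<open>\<sigma> \<notin> \<Delta>\<close> by (auto simp: M_def)
    then obtain \<tau> where \<tau>: "\<tau> \<in> M" "\<And>\<tau>'. \<tau>' \<in> M \<Longrightarrow> \<not> \<tau>' \<subset> \<tau>"
      using finite_has_minimal[of M] by (metis order.strict_iff_order)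
    have "\<tau> \<in> full_simplex N" using full_simplex_face[OF full] \<tau>(1) by (simp add: M_def)
    moreover have "\<tau>' \<in> \<Delta>" if "\<tau>' \<subset> \<tau>" "\<tau>' \<noteq> {}" for \<tau>'
      using \<tau>(2)[of \<tau>'] \<tau>(1) that by (auto simp: M_def)
    ultimately have "\<tau> \<in> rejected N \<Delta>" using \<tau>(1) by (simp add: rejected_def M_def)
    moreover have "\<tau> \<in> A" using \<sigma> \<tau>(1) by (simp add: surviving_def M_def)
    ultimately show False using A by blast
  qed
  then show "surviving N A = \<Delta>" using A subset_surviving_iff[OF \<Delta>] by blast
qed

text \<open>
  The probability that exactly the coins in \<open>A\<close> succeed, with arbitrary ring elements as success
  probabilities, so that it applies to indeterminates.
\<close>

definition coin_weight :: "'a set \<Rightarrow> ('a \<Rightarrow> 'b::comm_ring_1) \<Rightarrow> 'a set \<Rightarrow> 'b" where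
  "coin_weight E x A = (\<Prod>\<sigma>\<in>A. x \<sigma>) * (\<Prod>\<sigma>\<in>E - A. 1 - x \<sigma>)"

text \<open>
  Prescribing success on \<open>T\<close> and failure on \<open>M\<close> leaves a factor \<open>x \<sigma> + (1 - x \<sigma>) = 1\<close> for every
  other coin.  The identity is the expansion of a product of binomials in which the forbidden
  summands have been replaced by \<open>0\<close>.
\<close>

lemma sum_coin_weight:
  fixes x :: "'a \<Rightarrow> 'b::comm_ring_1"
  assumes E: "finite E" and TM: "T \<subseteq> E" "M \<subseteq> E" "T \<inter> M = {}"
  shows "(\<Sum>A | A \<subseteq> E \<and> T \<subseteq> A \<and> A \<inter> M = {}. coin_weight E x A)
    = (\<Prod>\<sigma>\<in>T. x \<sigma>) * (\<Prod>\<sigma>\<in>M. 1 - x \<sigma>)"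
proof -
  define f where "f \<sigma> = (if \<sigma> \<in> M then 0 else x \<sigma>)" for \<sigma>
  define g where "g \<sigma> = (if \<sigma> \<in> T then 0 else 1 - x \<sigma>)" for \<sigma>
  have fin: "finite T" "finite M" using E TM finite_subset by blast+
  have "(\<Prod>\<sigma>\<in>T. x \<sigma>) * (\<Prod>\<sigma>\<in>M. 1 - x \<sigma>) = (\<Prod>\<sigma>\<in>T. f \<sigma> + g \<sigma>) * (\<Prod>\<sigma>\<in>M. f \<sigma> + g \<sigma>)"
    using TM(3) by (intro arg_cong2[where f="(*)"] prod.cong) (auto simp: f_def g_def)
  also have "\<dots> = (\<Prod>\<sigma>\<in>T \<union> M. f \<sigma> + g \<sigma>)"
    using fin TM(3) by (simp add: prod.union_disjoint)
  also have "\<dots> = (\<Prod>\<sigma>\<in>E. f \<sigma> + g \<sigma>)"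
    using E TM by (intro prod.mono_neutral_left) (auto simp: f_def g_def)
  also have "\<dots> = (\<Sum>A\<in>Pow E. (\<Prod>\<sigma>\<in>A. f \<sigma>) * (\<Prod>\<sigma>\<in>E - A. g \<sigma>))"
    by (rule prod_add[OF E])
  also have "\<dots> = (\<Sum>A | A \<subseteq> E \<and> T \<subseteq> A \<and> A \<inter> M = {}. coin_weight E x A)"
  proof (rule sum.mono_neutral_cong_right)
    show "\<forall>A\<in>Pow E - {A. A \<subseteq> E \<and> T \<subseteq> A \<and> A \<inter> M = {}}. (\<Prod>\<sigma>\<in>A. f \<sigma>) * (\<Prod>\<sigma>\<in>E - A. g \<sigma>) = 0"
    proof
      fix A assume A: "A \<in> Pow E - {A. A \<subseteq> E \<and> T \<subseteq> A \<and> A \<inter> M = {}}"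
      then consider \<sigma> where "\<sigma> \<in> A" "\<sigma> \<in> M" | \<sigma> where "\<sigma> \<in> T" "\<sigma> \<notin> A" by blast
      then show "(\<Prod>\<sigma>\<in>A. f \<sigma>) * (\<Prod>\<sigma>\<in>E - A. g \<sigma>) = 0"
      proof cases
        case 1
        then have "(\<Prod>\<sigma>\<in>A. f \<sigma>) = 0"
          using A E by (intro prod_zero) (auto simp: f_def intro: finite_subset)
        then show ?thesis by simp
      next
        case 2
        then have "(\<Prod>\<sigma>\<in>E - A. g \<sigma>) = 0"
          using TM E by (intro prod_zero) (auto simp: g_def)
        then show ?thesis by simp
      qed
    qed
    show "(\<Prod>\<sigma>\<in>A. f \<sigma>) * (\<Prod>\<sigma>\<in>E - A. g \<sigma>) = coin_weight E x A"
      if "A \<in> {A. A \<subseteq> E \<and> T \<subseteq> A \<and> A \<inter> M = {}}" for A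
      unfolding coin_weight_def
      using that by (intro arg_cong2[where f="(*)"] prod.cong) (auto simp: f_def g_def)
  qed (use E in auto)
  finally show ?thesis by simp
qed

lemma realization_poly_conv_rejected:
  "realization_poly N \<Delta> = (\<Prod>\<sigma>\<in>\<Delta>. cell_var \<sigma>) * (\<Prod>\<sigma>\<in>rejected N \<Delta>. 1 - cell_var \<sigma>)"
  by (simp add: realization_poly_def rejected_def)

lemma realization_poly_eq_sum_coin_weight:
  assumes \<Delta>: "\<Delta> \<in> subcomplexes N"
  shows "realization_poly N \<Delta>
    = (\<Sum>A | A \<subseteq> full_simplex N \<and> surviving N A = \<Delta>. coin_weight (full_simplex N) cell_var A)"
proof -
  have "realization_poly N \<Delta> = (\<Sum>A | A \<subseteq> full_simplex N \<and> \<Delta> \<subseteq> A \<and> A \<inter> rejected N \<Delta> = {}.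
      coin_weight (full_simplex N) cell_var A)"
    unfolding realization_poly_conv_rejected
    by (rule sum_coin_weight[symmetric])
      (use subcomplexes_subset[OF \<Delta>] in \<open>auto simp: rejected_def\<close>)
  then show ?thesis by (simp add: surviving_eq_iff[OF \<Delta>])
qed

text \<open>
  The polynomial form of the statement that \<open>\<Gamma>\<close> is contained in the random complex with
  probability \<open>mon \<Gamma>\<close>.  Grouping the coin patterns by the complex they produce reduces it to the
  patterns that succeed on all of \<open>\<Gamma>\<close>.
\<close>

lemma sum_realization_poly_above:
  assumes \<Gamma>: "\<Gamma> \<in> subcomplexes N"
  shows "(\<Sum>\<Delta> | \<Delta> \<in> subcomplexes N \<and> \<Gamma> \<subseteq> \<Delta>. realization_poly N \<Delta>) = mon \<Gamma>"
proof -
  let ?w = "coin_weight (full_simplex N) cell_var"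
  let ?S = "{A. A \<subseteq> full_simplex N \<and> \<Gamma> \<subseteq> A}"
  have "(\<Sum>\<Delta> | \<Delta> \<in> subcomplexes N \<and> \<Gamma> \<subseteq> \<Delta>. realization_poly N \<Delta>)
      = (\<Sum>\<Delta> | \<Delta> \<in> subcomplexes N \<and> \<Gamma> \<subseteq> \<Delta>. \<Sum>A | A \<in> ?S \<and> surviving N A = \<Delta>. ?w A)"
  proof (rule sum.cong[OF refl])
    fix \<Delta> assume \<Delta>: "\<Delta> \<in> {\<Delta>. \<Delta> \<in> subcomplexes N \<and> \<Gamma> \<subseteq> \<Delta>}"
    then have "{A. A \<in> ?S \<and> surviving N A = \<Delta>} = {A. A \<subseteq> full_simplex N \<and> surviving N A = \<Delta>}"
      using surviving_eq_iff by blast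
    then show "realization_poly N \<Delta> = (\<Sum>A | A \<in> ?S \<and> surviving N A = \<Delta>. ?w A)"
      using \<Delta> by (simp add: realization_poly_eq_sum_coin_weight)
  qed
  also have "\<dots> = sum ?w ?S"
  proof (rule sum.group)
    show "surviving N ` ?S \<subseteq> {\<Delta>. \<Delta> \<in> subcomplexes N \<and> \<Gamma> \<subseteq> \<Delta>}"
      using surviving_in_subcomplexes subset_surviving_iff[OF \<Gamma>] by auto
  qed (use finite_subcomplexes in auto)
  also have "\<dots> = mon \<Gamma>"
    using sum_coin_weight[of "full_simplex N" \<Gamma> "{}" cell_var] subcomplexes_subset[OF \<Gamma>]
    by (simp add: mon_def)
  finally show ?thesis .
qed

text \<open>
  Linearity of expectation for a function of the complex of the form
  \<open>\<Delta> \<mapsto> \<Sum>i. a i * [G i \<subseteq> \<Delta>]\<close>; both cell counts and cycle ranks have this form.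
\<close>

lemma sum_realization_poly_weighted:
  assumes I: "finite I" and G: "\<And>i. i \<in> I \<Longrightarrow> G i \<in> subcomplexes N"
  shows "(\<Sum>\<Delta>\<in>subcomplexes N. (\<Sum>i | i \<in> I \<and> G i \<subseteq> \<Delta>. a i) * realization_poly N \<Delta>)
    = (\<Sum>i\<in>I. a i * mon (G i))"
proof -
  have "(\<Sum>\<Delta>\<in>subcomplexes N. (\<Sum>i | i \<in> I \<and> G i \<subseteq> \<Delta>. a i) * realization_poly N \<Delta>)
    = (\<Sum>i\<in>I. \<Sum>\<Delta> | \<Delta> \<in> subcomplexes N \<and> G i \<subseteq> \<Delta>. a i * realization_poly N \<Delta>)"
    unfolding sum_distrib_right by (rule sum.swap_restrict[OF finite_subcomplexes I])
  also have "\<dots> = (\<Sum>i\<in>I. a i * mon (G i))"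
    by (rule sum.cong[OF refl]) (simp add: sum_realization_poly_above[OF G] flip: sum_distrib_left)
  finally show ?thesis .
qed

section \<open>Expected cell counts and cycle ranks\<close>

lemma finite_kcells: "finite \<Delta> \<Longrightarrow> finite (kcells k \<Delta>)"
  by (simp add: kcells_def)

lemma finite_subcomplex: "\<Delta> \<in> subcomplexes N \<Longrightarrow> finite \<Delta>"
  using finite_subset[OF _ finite_full_simplex] subcomplexes_subset by blast

lemma generated_in_subcomplexes:
  "F \<subseteq> full_simplex N \<Longrightarrow> generated_complex F \<in> subcomplexes N"
  unfolding subcomplexes_def generated_complex_def using full_simplex_face by blast

lemma generated_subset_iff:
  assumes "\<Delta> \<in> subcomplexes N" "F \<subseteq> full_simplex N"
  shows "generated_complex F \<subseteq> \<Delta> \<longleftrightarrow> F \<subseteq> \<Delta>"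
proof
  assume "generated_complex F \<subseteq> \<Delta>"
  then show "F \<subseteq> \<Delta>" using assms(2) by (auto simp: generated_complex_def full_simplex_def)
next
  assume "F \<subseteq> \<Delta>"
  then show "generated_complex F \<subseteq> \<Delta>"
    using subcomplexes_face[OF assms(1)] by (auto simp: generated_complex_def)
qed

lemma kcells_generated:
  assumes F: "F \<subseteq> kcells k (full_simplex N)"
  shows "kcells k (generated_complex F) = F" "kcells (k + 1) (generated_complex F) = {}"
proof -
  have cell: "finite \<sigma>" "\<sigma> \<noteq> {}" "card \<sigma> = k + 1" if "\<sigma> \<in> F" for \<sigma>
    using that F by (auto simp: kcells_def full_simplex_def intro: finite_subset)
  have "\<tau> = \<sigma>" if "\<sigma> \<in> F" "\<tau> \<subseteq> \<sigma>" "card \<tau> = k + 1" for \<sigma> \<tau>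
    using cell[OF that(1)] that by (metis card_subset_eq)
  then show "kcells k (generated_complex F) = F"
    using cell by (auto simp: kcells_def generated_complex_def)
  have "card \<tau> \<noteq> k + 2" if "\<sigma> \<in> F" "\<tau> \<subseteq> \<sigma>" for \<sigma> \<tau>
    using cell[OF that(1)] card_mono[OF _ that(2)] by auto
  then show "kcells (k + 1) (generated_complex F) = {}"
    by (auto simp: kcells_def generated_complex_def)
qed

definition cycle_rank_moebius :: "'k::field itself \<Rightarrow> nat \<Rightarrow> nat set set \<Rightarrow> int" where
  "cycle_rank_moebius K k F = (\<Sum>S\<in>Pow F. (-1) ^ card S * int (cycle_rank K k (F - S)))"

text \<open>
  Without cells of dimension \<open>k + 1\<close> the \<open>k\<close>-th Betti number is the cycle rank.  The convention
  that \<open>c\<^sub>k\<close> vanishes together with the Betti number agrees with the alternating sum, since the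
  cycle rank is monotone and all summands vanish with the top one.
\<close>

lemma c_coeff_generated:
  assumes F: "F \<subseteq> kcells k (full_simplex N)"
  shows "c_coeff TYPE('k::field) k (generated_complex F) = cycle_rank_moebius TYPE('k) k F"
proof -
  have finF: "finite F" using F finite_kcells[OF finite_full_simplex] finite_subset by blast
  have betti: "betti TYPE('k) k (generated_complex F - S) = cycle_rank TYPE('k) k (F - S)" for S
  proof -
    have "kcells k (generated_complex F - S) = F - S" "kcells (k + 1) (generated_complex F - S) = {}"
      using kcells_generated[OF F] by (auto simp: kcells_def)
    then show ?thesis
      using cycle_rank_plus_dim_boundary[of "{}" "k + 1", where 'k='k]
      by (simp add: betti_eq_cycle_rank_minus)
  qed
  show ?thesis
  proof (cases "cycle_rank TYPE('k) k F = 0")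
    case True
    then have "cycle_rank TYPE('k) k (F - S) = 0" for S
      using cycle_rank_mono[OF finF, of "F - S" "TYPE('k)" k] by auto
    then show ?thesis by (simp add: c_coeff_def cycle_rank_moebius_def betti[of "{}", simplified] True)
  next
    case False
    then show ?thesis
      by (simp add: c_coeff_def cycle_rank_moebius_def betti kcells_generated[OF F] betti[of "{}", simplified])
  qed
qed

text \<open>
  Moebius inversion on the Boolean lattice, after replacing \<open>S\<close> by \<open>F - S\<close>.
\<close>

lemma sum_cycle_rank_moebius:
  assumes "finite H"
  shows "(\<Sum>F\<in>Pow H. cycle_rank_moebius K k F) = int (cycle_rank K k H)"
proof -
  let ?z = "\<lambda>F. int (cycle_rank K k F)"
  have moebius: "cycle_rank_moebius K k F = (-1) ^ card F * (\<Sum>T\<in>Pow F. (-1) ^ card T * ?z T)"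
    if "finite F" for F
  proof -
    have "(\<Sum>S\<in>Pow F. (-1) ^ card S * ?z (F - S))
        = (\<Sum>T\<in>Pow F. (-1) ^ card (F - T) * ?z T)"
      by (rule sum.reindex_bij_witness[of _ "\<lambda>T. F - T" "\<lambda>S. F - S"]) (auto simp: double_diff)
    also have "\<dots> = (\<Sum>T\<in>Pow F. (-1) ^ card F * ((-1) ^ card T * ?z T))"
    proof (rule sum.cong[OF refl])
      fix T assume "T \<in> Pow F"
      then have "card F = card (F - T) + card T"
        using card_Diff_subset[of T F] card_mono[of F T] finite_subset[of T F] that by simp
      then show "(-1) ^ card (F - T) * ?z T = (-1) ^ card F * ((-1) ^ card T * ?z T)"
        by (simp add: power_add flip: mult.assoc)
    qed
    finally show ?thesis by (simp add: cycle_rank_moebius_def sum_distrib_left)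
  qed
  have "?z H = (\<Sum>F\<in>Pow H. (-1) ^ card F * (\<Sum>T\<in>Pow F. (-1) ^ card T * ?z T))"
    by (rule inclusion_exclusion_symmetric[OF _ assms]) simp
  also have "\<dots> = (\<Sum>F\<in>Pow H. cycle_rank_moebius K k F)"
    using assms by (intro sum.cong) (auto simp: moebius finite_subset)
  finally show ?thesis ..
qed

lemma expected_card_kcells:
  "(\<Sum>\<Delta>\<in>subcomplexes N. of_nat (card (kcells k \<Delta>)) * realization_poly N \<Delta>) = d_poly N k"
proof -
  let ?I = "kcells k (full_simplex N)"
  have fin: "finite ?I" by (simp add: finite_kcells)
  have full: "{\<sigma>} \<subseteq> full_simplex N" if "\<sigma> \<in> ?I" for \<sigma> using that by (simp add: kcells_def)
  have "of_nat (card (kcells k \<Delta>)) = (\<Sum>\<sigma> | \<sigma> \<in> ?I \<and> generated_complex {\<sigma>} \<subseteq> \<Delta>. 1 :: cell_poly)"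
    if \<Delta>: "\<Delta> \<in> subcomplexes N" for \<Delta>
  proof -
    have "{\<sigma>. \<sigma> \<in> ?I \<and> generated_complex {\<sigma>} \<subseteq> \<Delta>} = kcells k \<Delta>"
      using generated_subset_iff[OF \<Delta> full] subcomplexes_subset[OF \<Delta>] by (auto simp: kcells_def)
    then show ?thesis by simp
  qed
  then show ?thesis
    using sum_realization_poly_weighted[OF fin, of "\<lambda>\<sigma>. generated_complex {\<sigma>}" N "\<lambda>_. 1"]
      generated_in_subcomplexes[OF full]
    by (simp add: d_poly_def)
qed

lemma pE_poly_zero: "pE_poly K N 0 = d_poly N 0"
proof -
  have "kcells 0 (full_simplex N) = (\<lambda>i. {i}) ` {1..N}"
    by (auto simp: kcells_def full_simplex_def card_1_singleton_iff)
  moreover have "generated_complex {{i}} = {{i}}" for i by (auto simp: generated_complex_def)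
  ultimately show ?thesis
    by (simp add: pE_poly_def d_poly_def mon_def sum.reindex)
qed

lemma expected_cycle_rank:
  "(\<Sum>\<Delta>\<in>subcomplexes N. of_nat (cycle_rank TYPE('k::field) k (kcells k \<Delta>)) * realization_poly N \<Delta>)
    = pE_poly TYPE('k) N k"
proof (cases "k = 0")
  case True
  have "cycle_rank TYPE('k) 0 (kcells 0 \<Delta>) = card (kcells 0 \<Delta>)" if "\<Delta> \<in> subcomplexes N" for \<Delta>
    using cycle_rank_zero finite_kcells finite_subcomplex that by blast
  then show ?thesis
    using expected_card_kcells[of 0 N] True by (simp add: pE_poly_zero)
next
  case False
  let ?I = "Pow (kcells k (full_simplex N))"
  let ?c = "cycle_rank_moebius TYPE('k) k"
  have fin: "finite ?I" by (simp add: finite_kcells)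
  have full: "F \<subseteq> full_simplex N" if "F \<in> ?I" for F using that by (auto simp: kcells_def)
  have "of_nat (cycle_rank TYPE('k) k (kcells k \<Delta>))
      = (\<Sum>F | F \<in> ?I \<and> generated_complex F \<subseteq> \<Delta>. of_int (?c F) :: cell_poly)"
    if \<Delta>: "\<Delta> \<in> subcomplexes N" for \<Delta>
  proof -
    have "{F. F \<in> ?I \<and> generated_complex F \<subseteq> \<Delta>} = Pow (kcells k \<Delta>)"
      using generated_subset_iff[OF \<Delta> full] subcomplexes_subset[OF \<Delta>] by (auto simp: kcells_def)
    then have "(\<Sum>F | F \<in> ?I \<and> generated_complex F \<subseteq> \<Delta>. of_int (?c F) :: cell_poly)
        = of_int (\<Sum>F\<in>Pow (kcells k \<Delta>). ?c F)" by simp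
    then show ?thesis
      by (simp only: sum_cycle_rank_moebius[OF finite_kcells[OF finite_subcomplex[OF \<Delta>]]]) simp
  qed
  then have "(\<Sum>\<Delta>\<in>subcomplexes N. of_nat (cycle_rank TYPE('k) k (kcells k \<Delta>)) * realization_poly N \<Delta>)
      = (\<Sum>F\<in>?I. of_int (?c F) * mon (generated_complex F))"
    using sum_realization_poly_weighted[OF fin, of generated_complex N "\<lambda>F. of_int (?c F)"]
      generated_in_subcomplexes[OF full] by simp
  \<comment> \<open>The empty set carries no cycles, so its coefficient is zero.\<close>
  also have "\<dots> = (\<Sum>F\<in>?I - {{}}. of_int (?c F) * mon (generated_complex F))"
    using fin by (intro sum.mono_neutral_right) (auto simp: cycle_rank_moebius_def cycle_rank_empty)
  also have "\<dots> = (\<Sum>F\<in>?I - {{}}. of_int (c_coeff TYPE('k) k (generated_complex F)) * mon (generated_complex F))"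
    by (rule sum.cong) (auto simp: c_coeff_generated)
  also have "\<dots> = pE_poly TYPE('k) N k"
  proof -
    have "inj_on generated_complex (?I - {{}})"
      by (rule inj_on_inverseI[of _ "kcells k"]) (auto simp: kcells_generated)
    then show ?thesis using False by (simp add: pE_poly_def sum.reindex)
  qed
  finally show ?thesis .
qed

section \<open>The expected Betti numbers\<close>

text \<open>
  By independence the event described in \<open>surviving_eq_iff\<close> has the probability given by the
  realization polynomial.
\<close>

lemma pmf_max_random_complex:
  assumes p: "\<And>\<sigma>. \<sigma> \<in> full_simplex N \<Longrightarrow> 0 \<le> p \<sigma> \<and> p \<sigma> \<le> 1"
    and \<Delta>: "\<Delta> \<in> subcomplexes N"
  shows "pmf (max_random_complex N p) \<Delta> = eval_poly p (realization_poly N \<Delta>)"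
proof -
  let ?E = "full_simplex N" and ?R = "rejected N \<Delta>"
  let ?coins = "Pi_pmf ?E False (\<lambda>\<sigma>. bernoulli_pmf (p \<sigma>))"
  define B where "B \<sigma> = (if \<sigma> \<in> \<Delta> then {True} else if \<sigma> \<in> ?R then {False} else UNIV)" for \<sigma>
  define h where "h \<sigma> = measure_pmf.prob (bernoulli_pmf (p \<sigma>)) (B \<sigma>)" for \<sigma>
  have sub: "\<Delta> \<subseteq> ?E" "?R \<subseteq> ?E" "\<Delta> \<inter> ?R = {}"
    using subcomplexes_subset[OF \<Delta>] by (auto simp: rejected_def)
  have vimage: "(\<lambda>coin. {\<sigma>\<in>?E. \<forall>\<tau>. \<tau> \<subseteq> \<sigma> \<and> \<tau> \<noteq> {} \<longrightarrow> coin \<tau>}) -` {\<Delta>} = Pi ?E B"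
  proof (rule set_eqI)
    fix coin :: "nat set \<Rightarrow> bool"
    have "coin \<in> (\<lambda>coin. {\<sigma>\<in>?E. \<forall>\<tau>. \<tau> \<subseteq> \<sigma> \<and> \<tau> \<noteq> {} \<longrightarrow> coin \<tau>}) -` {\<Delta>}
        \<longleftrightarrow> \<Delta> \<subseteq> Collect coin \<and> Collect coin \<inter> ?R = {}"
      using surviving_eq_iff[OF \<Delta>, of "Collect coin"] by (simp add: surviving_def)
    also have "\<dots> \<longleftrightarrow> (\<forall>\<sigma>\<in>?E. (\<sigma> \<in> \<Delta> \<longrightarrow> coin \<sigma>) \<and> (\<sigma> \<in> ?R \<longrightarrow> \<not> coin \<sigma>))"
      using sub by blast
    also have "\<dots> \<longleftrightarrow> coin \<in> Pi ?E B"
    proof -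
      have "coin \<sigma> \<in> B \<sigma> \<longleftrightarrow> (\<sigma> \<in> \<Delta> \<longrightarrow> coin \<sigma>) \<and> (\<sigma> \<in> ?R \<longrightarrow> \<not> coin \<sigma>)" for \<sigma>
        using sub(3) by (auto simp: B_def)
      then show ?thesis by (simp add: Pi_iff)
    qed
    finally show "coin \<in> (\<lambda>coin. {\<sigma>\<in>?E. \<forall>\<tau>. \<tau> \<subseteq> \<sigma> \<and> \<tau> \<noteq> {} \<longrightarrow> coin \<tau>}) -` {\<Delta>} \<longleftrightarrow> coin \<in> Pi ?E B" .
  qed
  have "pmf (max_random_complex N p) \<Delta> = (\<Prod>\<sigma>\<in>?E. h \<sigma>)"
    unfolding max_random_complex_def pmf_map vimage h_def
    by (rule measure_Pi_pmf_Pi) simp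
  also have "\<dots> = (\<Prod>\<sigma>\<in>\<Delta> \<union> ?R. h \<sigma>)"
    using sub by (intro prod.mono_neutral_right) (auto simp: h_def B_def)
  also have "\<dots> = (\<Prod>\<sigma>\<in>\<Delta>. h \<sigma>) * (\<Prod>\<sigma>\<in>?R. h \<sigma>)"
    using sub finite_subset[OF _ finite_full_simplex] by (intro prod.union_disjoint) blast+
  also have "\<dots> = (\<Prod>\<sigma>\<in>\<Delta>. p \<sigma>) * (\<Prod>\<sigma>\<in>?R. 1 - p \<sigma>)"
    using sub p by (intro arg_cong2[where f="(*)"] prod.cong)
      (auto simp: h_def B_def measure_pmf_single subset_iff disjoint_iff)
  also have "\<dots> = eval_poly p (realization_poly N \<Delta>)"
    by (simp add: realization_poly_conv_rejected eval_poly_mult eval_poly_prod eval_poly_one_minus eval_poly_cell_var)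
  finally show ?thesis .
qed

theorem theorem5:
  fixes N n :: nat
  shows "(\<forall>p :: nat set \<Rightarrow> real. (\<forall>\<sigma>\<in>full_simplex N. 0 \<le> p \<sigma> \<and> p \<sigma> \<le> 1) \<longrightarrow>
            measure_pmf.expectation (max_random_complex N p)
              (\<lambda>X. real (betti TYPE('k::field) n X))
            = eval_poly p (expected_betti_poly TYPE('k) N n))
         \<and> expected_betti_poly TYPE('k) N n
             = pE_poly TYPE('k) N n - d_poly N (n + 1) + pE_poly TYPE('k) N (n + 1)"
proof (intro conjI allI impI)
  fix p :: "nat set \<Rightarrow> real"
  assume p: "\<forall>\<sigma>\<in>full_simplex N. 0 \<le> p \<sigma> \<and> p \<sigma> \<le> 1"
  have "set_pmf (max_random_complex N p) \<subseteq> subcomplexes N"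
    unfolding max_random_complex_def set_map_pmf
    using surviving_in_subcomplexes[of N "Collect _"] by (auto simp: surviving_def)
  then have "measure_pmf.expectation (max_random_complex N p) (\<lambda>X. real (betti TYPE('k) n X))
      = (\<Sum>\<Delta>\<in>subcomplexes N. real (betti TYPE('k) n \<Delta>) * pmf (max_random_complex N p) \<Delta>)"
    by (intro integral_measure_pmf_real[OF finite_subcomplexes]) auto
  also have "\<dots> = eval_poly p (expected_betti_poly TYPE('k) N n)"
    using p by (simp add: expected_betti_poly_def eval_poly_sum eval_poly_mult eval_poly_of_nat
        pmf_max_random_complex)
  finally show "measure_pmf.expectation (max_random_complex N p) (\<lambda>X. real (betti TYPE('k) n X))
      = eval_poly p (expected_betti_poly TYPE('k) N n)" .
next
  let ?z = "\<lambda>k \<Delta>. cycle_rank TYPE('k) k (kcells k \<Delta>)"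
  have "of_nat (betti TYPE('k) n \<Delta>)
      = (of_nat (?z n \<Delta>) - of_nat (card (kcells (n + 1) \<Delta>)) + of_nat (?z (n + 1) \<Delta>) :: cell_poly)"
    if "\<Delta> \<in> subcomplexes N" for \<Delta>
    using arg_cong[OF betti_eq_cycle_ranks[OF that, of n, where 'k='k], of "of_int :: int \<Rightarrow> cell_poly"]
    by simp
  then have "expected_betti_poly TYPE('k) N n
      = (\<Sum>\<Delta>\<in>subcomplexes N. (of_nat (?z n \<Delta>) - of_nat (card (kcells (n + 1) \<Delta>))
          + of_nat (?z (n + 1) \<Delta>)) * realization_poly N \<Delta>)"
    unfolding expected_betti_poly_def by (intro sum.cong) simp_all
  also have "\<dots> = pE_poly TYPE('k) N n - d_poly N (n + 1) + pE_poly TYPE('k) N (n + 1)"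
    by (simp only: distrib_right left_diff_distrib sum.distrib sum_subtractf
        expected_cycle_rank expected_card_kcells)
  finally show "expected_betti_poly TYPE('k) N n
      = pE_poly TYPE('k) N n - d_poly N (n + 1) + pE_poly TYPE('k) N (n + 1)" .
qed

end
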